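(* Let $q$ and $t$ be odd primes such that $q=4t+1$. Then, for any integer $n\ge 1$, the factorization of $x^{2^nt}-1$ into the product of $2nt$ irreducible polynomials over $\mathbb{F}_q$ is given as $$x^{2^nt}-1=\prod_{j=0}^{t-1}\Bigl((x\pm 16^j)(x\pm\sqrt{-1}\cdot 16^j)\prod_{1\le r\le n-2}\bigl(x^{2^r}\pm\sqrt{-1}\cdot 16^j\bigr)\Bigr).$$
   Context: $\mathbb{F}_q$ is the finite field with $q$ elements; integers are read as elements of $\mathbb{F}_q$. $\sqrt{-1}$ denotes a fixed square root of $-1$ in $\mathbb{F}_q$. A factor written with $\pm$ in a product stands for the product of the two factors obtained from the two sign choices. Empty products equal $1$.
   Formalization: For n=1 the displayed identity is false (degree 2t on the left, 4t on the right); the formal theorem proves the display for n≥2 and, for n=1, the corrected x^{2t}-1=∏_{j<t}(x±16^j) with 2t irreducible factors, omitting the factors x±√-1·16^j. *)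

theory Defs
  imports
    "HOL-Computational_Algebra.Computational_Algebra"
    "HOL-Library.Cardinality"
    "HOL-Library.Multiset"
begin

abbreviation X :: "'a::comm_ring_1 poly" where
  "X \<equiv> [:0, 1:]"

text \<open>The two factors abbreviated by \<open>p \<plusminus> c\<close>.\<close>
definition pm_factors :: "'a::comm_ring_1 poly \<Rightarrow> 'a \<Rightarrow> 'a poly multiset" where
  "pm_factors p c = {# p + [:c:], p - [:c:] #}"

text \<open>The factors of the displayed product, as a multiset so that they can be counted;
  \<open>\<iota>\<close> is the chosen square root of \<open>-1\<close>. Meant for \<open>n \<ge> 2\<close>.\<close>
definition displayed_factors :: "'a::comm_ring_1 \<Rightarrow> nat \<Rightarrow> nat \<Rightarrow> 'a poly multiset" where
  "displayed_factors \<iota> t n =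
     (\<Sum>j = 0..<t. pm_factors X (16 ^ j) + pm_factors X (\<iota> * 16 ^ j) +
        (\<Sum>r = 1..n - 2. pm_factors (X ^ (2 ^ r)) (\<iota> * 16 ^ j)))"

text \<open>For \<open>n = 1\<close> the displayed product has degree \<open>4 * t\<close>, while \<open>X ^ (2 * t) - 1\<close>
  has degree \<open>2 * t\<close>; there only the factors \<open>X \<plusminus> 16 ^ j\<close> occur.\<close>
definition linear_factors :: "nat \<Rightarrow> 'a::comm_ring_1 poly multiset" where
  "linear_factors t = (\<Sum>j = 0..<t. pm_factors X (16 ^ j))"

lemma prod_mset_sum:
  fixes f :: "'b \<Rightarrow> 'a::comm_monoid_mult multiset"
  shows "prod_mset (sum f A) = (\<Prod>k\<in>A. prod_mset (f k))"
  by (induction A rule: infinite_finite_induct) auto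

lemma prod_mset_displayed_factors:
  "prod_mset (displayed_factors \<iota> t n) =
     (\<Prod>j = 0..<t.
        (X + [:16 ^ j:]) * (X - [:16 ^ j:]) *
        ((X + [:\<iota> * 16 ^ j:]) * (X - [:\<iota> * 16 ^ j:])) *
        (\<Prod>r = 1..n - 2.
           (X ^ (2 ^ r) + [:\<iota> * 16 ^ j:]) * (X ^ (2 ^ r) - [:\<iota> * 16 ^ j:])))"
  unfolding displayed_factors_def pm_factors_def prod_mset_sum
  by (simp only: prod_mset_sum prod_mset_Un prod_mset_empty
      prod_mset.add_mset mult_1_right mult.assoc)

lemma prod_mset_linear_factors:
  "prod_mset (linear_factors t) = (\<Prod>j = 0..<t. (X + [:16 ^ j:]) * (X - [:16 ^ j:]))"
  unfolding linear_factors_def pm_factors_def prod_mset_sum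
  by (simp only: prod_mset_empty prod_mset.add_mset mult_1_right)

end

theory Submission imports Defs
begin

text \<open>
  Two facts about the field \<open>K\<close> with \<open>q = 4 t + 1\<close> elements carry the proof.

  First, \<open>256 = 16\<^sup>2\<close> has multiplicative order \<open>t\<close>: \<open>16\<^sup>t = 2\<^bsup>q-1\<^esup> = 1\<close>, the exponent
  \<open>t\<close> is prime, and \<open>256 = 1\<close> would force \<open>q\<close> to divide \<open>255 = 3 \<sqdot> 5 \<sqdot> 17\<close>. Hence
  \<open>\<Prod>\<^sub>j (P - 256\<^sup>j) = P\<^sup>t - 1\<close> for every polynomial \<open>P\<close>, and as \<open>t\<close> is odd also
  \<open>\<Prod>\<^sub>j (P + 256\<^sup>j) = P\<^sup>t + 1\<close>. Multiplying \<open>P \<plusminus> 16\<^sup>j\<close> gives \<open>P\<^sup>2 - 256\<^sup>j\<close>, and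
  multiplying \<open>P \<plusminus> \<iota> 16\<^sup>j\<close> gives \<open>P\<^sup>2 + 256\<^sup>j\<close>, so the products over \<open>j\<close> are
  \<open>P\<^bsup>2t\<^esup> - 1\<close> and \<open>P\<^bsup>2t\<^esup> + 1\<close> (\<open>prod_pm_16\<close>, \<open>prod_pm_iota_16\<close>). Taking
  \<open>P = x\<close> in both and \<open>P = x\<^bsup>2^r\<^esup>\<close> in the second, the factors telescope to
  \<open>x\<^bsup>2^n t\<^esup> - 1\<close>.

  Second, \<open>\<plusminus>\<iota> 16\<^sup>j\<close> is not a square in \<open>K\<close>: its power with exponent \<open>2 t = (q - 1)/2\<close> is
  \<open>(-1)\<^sup>t = -1\<close> (\<open>nonsquare\<close>). Over a field in which \<open>-1\<close> is a square, \<open>x\<^bsup>2^r\<^esup> - a\<close>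
  is irreducible for every non-square \<open>a\<close> (\<open>irreducible_binomial_power_of_two\<close>).
  This follows by induction on \<open>r\<close> from a criterion
  for \<open>f(x\<^sup>2)\<close> to be irreducible when \<open>f\<close> is (\<open>irreducible_pcompose_square\<close>), proved by
  applying the norm \<open>p(x) p(-x)\<close> from \<open>K[x]\<close> to \<open>K[x\<^sup>2]\<close> to a factorization.
\<close>

section \<open>Irreducibility under the substitution of a square\<close>

lemma pcompose_X_power:
  fixes P :: "'a::comm_ring_1 poly"
  shows "X ^ m \<circ>\<^sub>p P = P ^ m"
  by (induction m) (simp_all add: pcompose_1 pcompose_mult pcompose_pCons del: mult_pCons_left)

lemma pcompose_square_neg:
  fixes f :: "'a::comm_ring_1 poly"
  shows "(f \<circ>\<^sub>p X\<^sup>2) \<circ>\<^sub>p [:0, -1:] = f \<circ>\<^sub>p X\<^sup>2"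
proof -
  have "X\<^sup>2 \<circ>\<^sub>p [:0, -1:] = (X\<^sup>2 :: 'a poly)"
    unfolding pcompose_X_power by (simp add: power2_eq_square)
  then show ?thesis by (simp flip: pcompose_assoc)
qed

lemma even_odd_decomposition_poly:
  fixes p :: "'a::comm_ring_1 poly"
  shows "\<exists>u v. p = u \<circ>\<^sub>p X\<^sup>2 + X * (v \<circ>\<^sub>p X\<^sup>2)"
proof (induction p)
  case 0
  show ?case by (rule exI[of _ 0], rule exI[of _ 0]) simp
next
  case (pCons a p)
  then obtain u v where uv: "p = u \<circ>\<^sub>p X\<^sup>2 + X * (v \<circ>\<^sub>p X\<^sup>2)" by blast
  have "pCons a p = [:a:] + X * p" by simp
  also have "\<dots> = (pCons a v) \<circ>\<^sub>p X\<^sup>2 + X * (u \<circ>\<^sub>p X\<^sup>2)"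
    unfolding uv pcompose_pCons by (simp only: power2_eq_square algebra_simps)
  finally show ?case by blast
qed

text \<open>The polynomial \<open>p(x) p(-x)\<close> is the norm of \<open>p\<close> from \<open>K[x]\<close> down to
  \<open>K[x\<^sup>2]\<close>: with \<open>p = u(x\<^sup>2) + x v(x\<^sup>2)\<close> it is \<open>(u\<^sup>2 - y v\<^sup>2)(y)\<close> at \<open>y = x\<^sup>2\<close>.
  Its constant and leading coefficients are squares up to sign; this restricts which
  polynomials can be norms.\<close>
lemma norm_to_even_subring:
  fixes p :: "'a::field poly"
  obtains h where "h \<circ>\<^sub>p X\<^sup>2 = p * (p \<circ>\<^sub>p [:0, -1:])"
    and "degree h = degree p"
    and "lead_coeff h = (-1) ^ degree p * (lead_coeff p)\<^sup>2"
    and "poly h 0 = (poly p 0)\<^sup>2"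
proof -
  obtain u v where uv: "p = u \<circ>\<^sub>p X\<^sup>2 + X * (v \<circ>\<^sub>p X\<^sup>2)"
    using even_odd_decomposition_poly by blast
  define h where "h = u\<^sup>2 - X * v\<^sup>2"
  have "p \<circ>\<^sub>p [:0, -1:] = u \<circ>\<^sub>p X\<^sup>2 - X * (v \<circ>\<^sub>p X\<^sup>2)"
    unfolding uv by (simp add: pcompose_add pcompose_mult pcompose_pCons pcompose_square_neg)
  moreover have "h \<circ>\<^sub>p X\<^sup>2 = (u \<circ>\<^sub>p X\<^sup>2)\<^sup>2 - X\<^sup>2 * (v \<circ>\<^sub>p X\<^sup>2)\<^sup>2"
    unfolding h_def by (simp only: pcompose_diff pcompose_mult power2_eq_square
        pcompose_pCons pcompose_0) simp
  moreover have "(U + X * V) * (U - X * V) = U\<^sup>2 - X\<^sup>2 * V\<^sup>2" for U V :: "'a poly"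
    by (simp only: power2_eq_square algebra_simps)
  ultimately have h: "h \<circ>\<^sub>p X\<^sup>2 = p * (p \<circ>\<^sub>p [:0, -1:])"
    using uv by (metis (no_types))
  have dX: "degree (X\<^sup>2 :: 'a poly) = 2" by (simp add: degree_power_eq)
  have lX: "lead_coeff (X\<^sup>2 :: 'a poly) = 1" unfolding lead_coeff_power by simp
  have dp: "degree (p \<circ>\<^sub>p [:0, -1:]) = degree p" by (simp add: degree_pcompose)
  have "degree h * 2 = degree (p * (p \<circ>\<^sub>p [:0, -1:]))"
    by (simp add: degree_pcompose dX flip: h)
  also have "\<dots> = degree p * 2"
    by (cases "p = 0") (simp_all add: degree_mult_eq dp pcompose_eq_0_iff)
  finally have d: "degree h = degree p" by simp
  have "lead_coeff h = lead_coeff (h \<circ>\<^sub>p X\<^sup>2)"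
    by (subst lead_coeff_comp) (simp_all add: dX lX[unfolded dX])
  also have "\<dots> = (-1) ^ degree p * (lead_coeff p)\<^sup>2"
    unfolding h lead_coeff_mult
    by (subst lead_coeff_comp) (simp_all add: power2_eq_square)
  finally have l: "lead_coeff h = (-1) ^ degree p * (lead_coeff p)\<^sup>2" .
  have "poly h 0 = poly (h \<circ>\<^sub>p X\<^sup>2) 0" by (simp add: poly_pcompose)
  also have "\<dots> = (poly p 0)\<^sup>2"
    unfolding h by (simp add: poly_pcompose power2_eq_square)
  finally show thesis using that h d l by blast
qed

text \<open>A factorization \<open>f(x\<^sup>2) = A B\<close> gives \<open>N(A) N(B) = f\<^sup>2\<close> on norms. As \<open>f\<close> is prime,
  either one norm, hence one factor, is constant, or both norms are associated to
  \<open>f\<close>. In the latter case \<open>f(0)\<close> is the leading coefficient of \<open>f\<close> times a square, up to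
  sign, which the hypothesis excludes.\<close>
lemma irreducible_pcompose_square:
  fixes f :: "'a::field poly"
  assumes irr: "irreducible f"
    and pos: "\<And>b. poly f 0 \<noteq> b\<^sup>2 * lead_coeff f"
    and neg: "\<And>b. poly f 0 \<noteq> - (b\<^sup>2 * lead_coeff f)"
  shows "irreducible (f \<circ>\<^sub>p X\<^sup>2)"
proof (rule irreducibleI)
  have dX: "degree (X\<^sup>2 :: 'a poly) = 2" by (simp add: degree_power_eq)
  have f0: "f \<noteq> 0" and nu: "\<not> is_unit f" using irr by (auto simp: irreducible_def)
  have prime: "prime_elem f" using irr by (rule field_poly_irreducible_imp_prime)
  show "f \<circ>\<^sub>p X\<^sup>2 \<noteq> 0" using f0 by (simp add: pcompose_eq_0_iff dX)
  have "degree f > 0" using f0 nu is_unit_iff_degree by blast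
  then have "degree (f \<circ>\<^sub>p X\<^sup>2) > 0" by (simp add: degree_pcompose dX)
  then show "\<not> is_unit (f \<circ>\<^sub>p X\<^sup>2)"
    using is_unit_iff_degree[OF \<open>f \<circ>\<^sub>p X\<^sup>2 \<noteq> 0\<close>] by simp
  fix A B assume AB: "f \<circ>\<^sub>p X\<^sup>2 = A * B"
  then have A0: "A \<noteq> 0" and B0: "B \<noteq> 0" using \<open>f \<circ>\<^sub>p X\<^sup>2 \<noteq> 0\<close> by auto
  obtain g where g: "g \<circ>\<^sub>p X\<^sup>2 = A * (A \<circ>\<^sub>p [:0, -1:])" "degree g = degree A"
      "lead_coeff g = (-1) ^ degree A * (lead_coeff A)\<^sup>2" "poly g 0 = (poly A 0)\<^sup>2"
    by (rule norm_to_even_subring)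
  obtain h where h: "h \<circ>\<^sub>p X\<^sup>2 = B * (B \<circ>\<^sub>p [:0, -1:])" "degree h = degree B"
    by (rule norm_to_even_subring)
  have g0: "g \<noteq> 0" and h0: "h \<noteq> 0"
    using g(1) h(1) A0 B0 by (auto simp: pcompose_eq_0_iff)
  have gA: "is_unit g \<Longrightarrow> is_unit A" and hB: "is_unit h \<Longrightarrow> is_unit B"
    using g(2) h(2) g0 h0 A0 B0 by (simp_all add: is_unit_iff_degree)
  have "(A * B) \<circ>\<^sub>p [:0, -1:] = A * B"
    unfolding AB[symmetric] by (rule pcompose_square_neg)
  then have "(g * h - f\<^sup>2) \<circ>\<^sub>p X\<^sup>2 = 0"
    by (simp add: pcompose_diff pcompose_mult power2_eq_square[of f] AB g h)
  then have gh: "g * h = f\<^sup>2"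
    by (simp only: pcompose_eq_0_iff dX) simp
  show "is_unit A \<or> is_unit B"
  proof (cases "f dvd g \<and> f dvd h")
    case True
    then obtain k l where k: "g = f * k" and l: "h = f * l" by (auto elim!: dvdE)
    with gh f0 have "k * l = 1" by (simp add: power2_eq_square)
    then have "is_unit k" by (metis dvd_triv_left)
    then obtain c where c: "k = [:c:]" "c dvd 1" by (auto simp: is_unit_poly_iff)
    have c0: "c \<noteq> 0" using c(2) by auto
    have v: "c * poly f 0 = (poly A 0)\<^sup>2" using g(4) by (simp add: k c(1) mult.commute)
    have w: "c * lead_coeff f = (-1) ^ degree A * (lead_coeff A)\<^sup>2"
      using g(3) c0 by (simp add: k c(1))
    define b where "b = poly A 0 / lead_coeff A"
    have lA: "lead_coeff A \<noteq> 0" using A0 by simp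
    have "c * (b\<^sup>2 * lead_coeff f) = b\<^sup>2 * (c * lead_coeff f)" by simp
    also have "\<dots> = (-1) ^ degree A * (b * lead_coeff A)\<^sup>2"
      unfolding w by (simp add: power_mult_distrib)
    also have "b * lead_coeff A = poly A 0" using lA by (simp add: b_def)
    finally have "c * (b\<^sup>2 * lead_coeff f) = (-1) ^ degree A * (c * poly f 0)"
      by (simp add: v)
    moreover have "(-1 :: 'a) ^ degree A = 1 \<or> (-1 :: 'a) ^ degree A = -1"
      by (cases "even (degree A)") auto
    ultimately have "c * (b\<^sup>2 * lead_coeff f) = c * poly f 0
        \<or> c * (b\<^sup>2 * lead_coeff f) = c * (- poly f 0)"
      by auto
    then have "poly f 0 = b\<^sup>2 * lead_coeff f \<or> poly f 0 = - (b\<^sup>2 * lead_coeff f)"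
      using c0 by (auto simp del: mult_minus_right)
    then show ?thesis using pos neg by blast
  next
    case False
    have unit: "is_unit y" if "y * z = f\<^sup>2" "\<not> f dvd y" for y z
    proof -
      have "f\<^sup>2 dvd z" using prime_power_dvd_multD[OF prime, of 2 y z] that by simp
      then obtain m where "z = f\<^sup>2 * m" by (auto elim!: dvdE)
      with that(1) have "f\<^sup>2 * (y * m) = f\<^sup>2 * 1" by (simp add: mult_ac)
      then have "y * m = 1" using f0 by simp
      then show ?thesis by (metis dvd_triv_left)
    qed
    show ?thesis
      using False unit[of g h] unit[of h g] gh gA hB by (auto simp: mult.commute)
  qed
qed

text \<open>Repeated substitution of \<open>x\<^sup>2\<close> into \<open>x - a\<close>: all polynomials met are monic with
  constant term \<open>-a\<close>, and since \<open>-1\<close> is a square neither \<open>a\<close> nor \<open>-a\<close> is one.\<close>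
lemma irreducible_binomial_power_of_two:
  fixes a i :: "'a::field"
  assumes i: "i\<^sup>2 = -1" and nonsquare: "\<And>b. b\<^sup>2 \<noteq> a"
  shows "irreducible (X ^ 2 ^ r - [:a:])"
proof (induction r)
  case 0
  show ?case using irreducible_linear_field_poly[of 1 "-a"] by simp
next
  case (Suc r)
  define f where "f = X ^ 2 ^ r - [:a:]"
  have f: "f \<circ>\<^sub>p X\<^sup>2 = X ^ 2 ^ Suc r - [:a:]"
    by (simp add: f_def pcompose_diff pcompose_X_power flip: power_mult)
  have "f = [:-a:] + monom 1 (2 ^ r)" by (simp add: f_def monom_altdef)
  moreover have "degree [:-a:] < degree (monom (1 :: 'a) (2 ^ r))"
    by (simp add: degree_monom_eq)
  ultimately have l: "lead_coeff f = 1"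
    by (simp only: lead_coeff_add_le lead_coeff_monom)
  have c: "poly f 0 = -a" by (simp add: f_def)
  \<comment> \<open>Otherwise \<open>a = (i b)\<^sup>2\<close>.\<close>
  have "-a \<noteq> b\<^sup>2" for b
    using nonsquare[of "i * b"] i
    by (metis add.inverse_inverse mult_minus1 power_mult_distrib)
  then show ?case unfolding f[symmetric]
    using Suc.IH nonsquare by (intro irreducible_pcompose_square) (auto simp: l c f_def[symmetric])
qed

section \<open>Products over a cyclic group of prime order\<close>

lemma inj_on_powers_prime_order:
  fixes c :: "'a::field"
  assumes "prime t" "c ^ t = 1" "c \<noteq> 1"
  shows "inj_on (\<lambda>j. c ^ j) {0..<t}"
proof (rule linorder_inj_onI)
  fix j k assume "j < k" and jk: "j \<in> {0..<t}" "k \<in> {0..<t}"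
  show "c ^ j \<noteq> c ^ k"
  proof
    assume "c ^ j = c ^ k"
    have c0: "c \<noteq> 0" using assms by (auto simp: power_0_left prime_gt_0_nat)
    define d where "d = k - j"
    have "c ^ j * c ^ d = c ^ j * 1"
      using \<open>c ^ j = c ^ k\<close> \<open>j < k\<close> power_add[of c j d] by (simp add: d_def)
    then have d: "c ^ d = 1" using c0 by simp
    have "0 < d" "d < t" using jk \<open>j < k\<close> by (auto simp: d_def)
    then have "coprime d t"
      using assms(1) by (metis coprime_commute prime_imp_coprime_nat nat_dvd_not_less)
    then obtain x y where "d * x = t * y + 1"
      using bezout_nat[of d t] \<open>0 < d\<close> by auto
    then have "(c ^ d) ^ x = (c ^ t) ^ y * c" by (simp flip: power_mult add: power_add)
    then show False using d assms by simp
  qed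
qed (auto)

text \<open>For \<open>P = x\<close> both sides are monic of degree \<open>t\<close> and vanish at the \<open>t\<close> distinct
  powers of \<open>c\<close>; substitution gives every other \<open>P\<close>.\<close>
lemma prod_minus_powers_prime_order:
  fixes c :: "'a::field" and P :: "'a poly"
  assumes t: "prime t" and c: "c ^ t = 1" "c \<noteq> 1"
  shows "(\<Prod>j = 0..<t. P - [:c ^ j:]) = P ^ t - 1"
proof -
  have t0: "t > 0" using t by (rule prime_gt_0_nat)
  let ?L = "\<Prod>j = 0..<t. X - [:c ^ j:]"
  have dL: "degree ?L = t" by (subst degree_prod_sum_eq) auto
  have lL: "coeff ?L t = 1"
    using lead_coeff_prod[of "\<lambda>j. X - [:c ^ j:]" "{0..<t}"] dL by simp
  have dR: "degree (monom 1 t - 1 :: 'a poly) \<le> t"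
    by (rule degree_diff_le) (auto simp: degree_monom_le)
  have "?L = monom 1 t - 1"
  proof (rule poly_eqI_degree_lead_coeff[where n = t and A = "(\<lambda>j. c ^ j) ` {0..<t}"])
    show "coeff ?L t = coeff (monom 1 t - 1) t" using t0 lL by simp
    show "t \<le> card ((\<lambda>j. c ^ j) ` {0..<t})"
      by (simp add: card_image inj_on_powers_prime_order[OF t c])
    fix z assume "z \<in> (\<lambda>j. c ^ j) ` {0..<t}"
    then obtain k where k: "k < t" "z = c ^ k" by auto
    have "z ^ t = (c ^ t) ^ k" by (simp add: k mult.commute flip: power_mult)
    then have "z ^ t = 1" by (simp add: c)
    moreover have "(\<Prod>j = 0..<t. z - c ^ j) = 0" using k by (auto intro!: prod_zero)
    ultimately show "poly ?L z = poly (monom 1 t - 1) z"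
      by (simp add: poly_prod poly_monom)
  qed (use dL dR in auto)
  then have "?L \<circ>\<^sub>p P = (X ^ t - 1) \<circ>\<^sub>p P" by (simp add: monom_altdef)
  moreover have "X \<circ>\<^sub>p P = P" by (simp add: pcompose_pCons)
  ultimately show ?thesis
    by (simp only: pcompose_prod pcompose_diff pcompose_1 pcompose_const pcompose_X_power)
qed

text \<open>Replacing \<open>P\<close> by \<open>-P\<close> in \<open>prod_minus_powers_prime_order\<close> changes the sign of
  each of the \<open>t\<close> factors and of \<open>P\<^sup>t\<close>; \<open>t\<close> is odd.\<close>
lemma prod_plus_powers_prime_order:
  fixes c :: "'a::field" and P :: "'a poly"
  assumes "prime t" "odd t" "c ^ t = 1" "c \<noteq> 1"
  shows "(\<Prod>j = 0..<t. P + [:c ^ j:]) = P ^ t + 1"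
proof -
  have "(\<Prod>j = 0..<t. P + [:c ^ j:]) = (\<Prod>j = 0..<t. (-1) * (- P - [:c ^ j:]))"
    by (rule prod.cong) auto
  also have "\<dots> = (-1) ^ t * ((- P) ^ t - 1)"
    by (simp only: prod.distrib prod_minus_powers_prime_order[OF assms(1,3,4)])
      simp
  also have "\<dots> = P ^ t + 1" using assms(2) by simp
  finally show ?thesis .
qed

lemma prod_power_two_telescope:
  fixes y :: "'a::comm_ring_1"
  shows "(y - 1) * (\<Prod>r = 1..m. y ^ 2 ^ (r - 1) + 1) = y ^ 2 ^ m - 1"
proof (induction m)
  case (Suc m)
  have "(y - 1) * (\<Prod>r = 1..Suc m. y ^ 2 ^ (r - 1) + 1)
      = (y ^ 2 ^ m - 1) * (y ^ 2 ^ m + 1)"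
    by (simp only: prod.nat_ivl_Suc' Suc.IH[symmetric]) (simp add: mult_ac)
  also have "\<dots> = (y ^ 2 ^ m)\<^sup>2 - 1" by (simp add: algebra_simps power2_eq_square)
  also have "\<dots> = y ^ 2 ^ Suc m - 1" by (simp add: mult.commute flip: power_mult)
  finally show ?case .
qed simp

section \<open>The field with \<open>4 t + 1\<close> elements\<close>

lemma power_card_minus_1_eq_1:
  fixes x :: "'a::{field,finite}"
  assumes "x \<noteq> 0"
  shows "x ^ (CARD('a) - 1) = 1"
proof -
  let ?U = "UNIV - {0 :: 'a}"
  have "bij_betw (\<lambda>y. x * y) ?U ?U"
    by (rule bij_betw_byWitness[where f' = "\<lambda>y. y / x"]) (use assms in auto)
  then have "\<Prod>?U = (\<Prod>y\<in>?U. x * y)"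
    using prod.reindex_bij_betw[of "\<lambda>y. x * y" ?U ?U "\<lambda>y. y"] by simp
  also have "\<dots> = x ^ (CARD('a) - 1) * \<Prod>?U"
    by (simp add: prod.distrib card_Diff_singleton)
  finally show ?thesis by simp
qed

lemma of_nat_eq_0_iff_prime_card_dvd:
  assumes "prime CARD('a::{field,finite})"
  shows "(of_nat m :: 'a) = 0 \<longleftrightarrow> CARD('a) dvd m"
proof -
  \<comment> \<open>Translation by \<open>1\<close> permutes the field, so summing over all elements gives
    \<open>CARD('a) \<sqdot> 1 = 0\<close>.\<close>
  have "(\<Sum>x\<in>UNIV. x + 1 :: 'a) = (\<Sum>x\<in>UNIV. x)"
    by (rule sum.reindex_bij_witness[of _ "\<lambda>x. x - 1" "\<lambda>x. x + 1"]) auto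
  then have "(of_nat CARD('a) :: 'a) = 0" by (simp add: sum.distrib)
  then have "CHAR('a) dvd CARD('a)" by (simp add: of_nat_eq_0_iff_char_dvd)
  then have "CHAR('a) = CARD('a)"
    using assms CHAR_not_1[where 'a = 'a] by (auto simp: prime_nat_iff)
  then show ?thesis by (simp add: of_nat_eq_0_iff_char_dvd)
qed

locale field_4t_plus_1 =
  fixes t :: nat and \<iota> :: "'a::{field,finite}"
  assumes prime_card: "prime CARD('a)"
    and prime_t: "prime t" and odd_t: "odd t"
    and card: "CARD('a) = 4 * t + 1"
    and iota: "\<iota>\<^sup>2 = -1"
begin

lemma two_nonzero: "(2 :: 'a) \<noteq> 0"
proof
  assume "(2 :: 'a) = 0"
  then have "CARD('a) dvd 2"
    using of_nat_eq_0_iff_prime_card_dvd[OF prime_card, of 2] by simp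
  then have "CARD('a) \<le> 2" by (rule dvd_imp_le) simp
  then show False using card prime_gt_1_nat[OF prime_t] by simp
qed

lemma power_4t: "x ^ (4 * t) = 1" if "x \<noteq> 0" for x :: 'a
  using power_card_minus_1_eq_1[OF that] card by simp

lemma power_t_16: "(16 :: 'a) ^ t = 1"
  using power_4t[OF two_nonzero] by (simp add: power_mult)

lemma power_t_256: "(256 :: 'a) ^ t = 1"
proof -
  have "(256 :: 'a) ^ t = (16 * 16) ^ t" by simp
  then show ?thesis by (simp only: power_mult_distrib power_t_16 mult_1)
qed

text \<open>The only prime divisors of \<open>255 = 3 \<sqdot> 5 \<sqdot> 17\<close> of the form \<open>4 t + 1\<close> are
  \<open>5\<close> and \<open>17\<close>, with \<open>t = 1\<close> and \<open>t = 4\<close>; neither is an odd prime.\<close>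
lemma ne_1_256: "(256 :: 'a) \<noteq> 1"
proof
  assume "(256 :: 'a) = 1"
  moreover have "of_nat 255 = (256 :: 'a) - 1" by simp
  ultimately have "of_nat 255 = (0 :: 'a)" by simp
  then have "CARD('a) dvd 3 * (5 * 17)"
    using of_nat_eq_0_iff_prime_card_dvd[OF prime_card, of 255] by simp
  then have "CARD('a) dvd 3 \<or> CARD('a) dvd 5 \<or> CARD('a) dvd 17"
    using prime_card by (metis prime_dvd_mult_iff)
  moreover have p3: "prime (3 :: nat)" and p5: "prime (5 :: nat)" and p17: "prime (17 :: nat)"
    by simp_all
  ultimately have "CARD('a) \<in> {3, 5, 17}"
    using prime_card primes_dvd_imp_eq[of "CARD('a)"]
    by (metis insertCI p3 p5 p17)
  then show False using card odd_t prime_gt_1_nat[OF prime_t] by auto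
qed

text \<open>If \<open>b\<^sup>2 = \<plusminus>\<iota> 16\<^sup>j\<close>, then raising to the power \<open>2 t\<close> kills \<open>16\<^sup>j\<close> and yields
  \<open>1 = b\<^bsup>4t\<^esup> = \<iota>\<^bsup>2t\<^esup> = (-1)\<^sup>t = -1\<close>.\<close>
lemma nonsquare:
  fixes s b :: 'a
  assumes "s\<^sup>2 = 1"
  shows "b\<^sup>2 \<noteq> s * (\<iota> * 16 ^ j)"
proof
  assume b: "b\<^sup>2 = s * (\<iota> * 16 ^ j)"
  have "(16 :: 'a) = 2 ^ 4" by simp
  then have "(16 :: 'a) \<noteq> 0" using two_nonzero by (metis power_not_zero)
  moreover have "\<iota> \<noteq> 0" "s \<noteq> 0" using iota assms by auto
  ultimately have "b \<noteq> 0" using b by auto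
  then have "1 = b ^ (4 * t)" by (simp add: power_4t)
  also have "\<dots> = ((b\<^sup>2)\<^sup>2) ^ t" by (simp flip: power_mult)
  also have "(b\<^sup>2)\<^sup>2 = - ((16 ^ j)\<^sup>2)"
    unfolding b by (simp add: power_mult_distrib assms iota)
  also have "\<dots> ^ t = - (((16 ^ t) ^ j)\<^sup>2)"
    using odd_t by (simp add: mult_ac flip: power_mult)
  finally show False
    using two_nonzero by (simp add: power_t_16 eq_neg_iff_add_eq_0)
qed

lemma irreducible_binomials:
  "irreducible (X ^ 2 ^ r + [:\<iota> * 16 ^ j:])" "irreducible (X ^ 2 ^ r - [:\<iota> * 16 ^ j:])"
proof -
  show "irreducible (X ^ 2 ^ r - [:\<iota> * 16 ^ j:])"
    using irreducible_binomial_power_of_two[OF iota nonsquare[of 1 _ j]] by simp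
  have "X ^ 2 ^ r + [:\<iota> * 16 ^ j:] = X ^ 2 ^ r - [:-1 * (\<iota> * 16 ^ j):]" by simp
  then show "irreducible (X ^ 2 ^ r + [:\<iota> * 16 ^ j:])"
    using irreducible_binomial_power_of_two[OF iota nonsquare[of "-1" _ j], of r] by (simp only:) simp
qed

lemma irreducible_linear_factors:
  fixes c :: 'a
  shows "irreducible (X + [:c:])" "irreducible (X - [:c:])"
  by (simp_all add: irreducible_linear_field_poly)

lemma prod_pm_16:
  fixes P :: "'a poly"
  shows "(\<Prod>j = 0..<t. (P + [:16 ^ j:]) * (P - [:16 ^ j:])) = P ^ (2 * t) - 1"
proof -
  have "(P + [:16 ^ j:]) * (P - [:16 ^ j:]) = P\<^sup>2 - [:256 ^ j:]" for j
  proof -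
    have "[:(16 :: 'a) ^ j:] * [:16 ^ j:] = [:256 ^ j:]"
      by (simp flip: power_mult_distrib)
    then show ?thesis
      by (simp only: square_diff_square_factored[symmetric] power2_eq_square)
  qed
  then show ?thesis
    by (simp only: prod_minus_powers_prime_order[OF prime_t power_t_256 ne_1_256] power_mult)
qed

lemma prod_pm_iota_16:
  fixes P :: "'a poly"
  shows "(\<Prod>j = 0..<t. (P + [:\<iota> * 16 ^ j:]) * (P - [:\<iota> * 16 ^ j:])) = P ^ (2 * t) + 1"
proof -
  have "(P + [:\<iota> * 16 ^ j:]) * (P - [:\<iota> * 16 ^ j:]) = P\<^sup>2 + [:256 ^ j:]" for j
  proof -
    have "(\<iota> * 16 ^ j) * (\<iota> * 16 ^ j) = \<iota>\<^sup>2 * (16 * 16) ^ j"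
      by (simp only: power2_eq_square power_mult_distrib mult_ac)
    then have "[:\<iota> * 16 ^ j:] * [:\<iota> * 16 ^ j:] = - [:256 ^ j:]"
      by (simp add: iota)
    then show ?thesis
      by (simp only: square_diff_square_factored[symmetric] power2_eq_square) simp
  qed
  then show ?thesis
    by (simp only: prod_plus_powers_prime_order[OF prime_t odd_t power_t_256 ne_1_256] power_mult)
qed

text \<open>With \<open>y = x\<^bsup>4t\<^esup>\<close> the factors \<open>x\<^bsup>2^r\<^esup> \<plusminus> \<iota> 16\<^sup>j\<close> of one fixed \<open>r\<close> multiply to
  \<open>y\<^bsup>2^(r-1)\<^esup> + 1\<close>, and the linear ones to \<open>(x\<^bsup>2t\<^esup> - 1)(x\<^bsup>2t\<^esup> + 1) = y - 1\<close>.\<close>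
lemma factorization:
  assumes "n \<ge> 2"
  shows "(X :: 'a poly) ^ (2 ^ n * t) - 1 =
             (\<Prod>j = 0..<t.
                (X + [:16 ^ j:]) * (X - [:16 ^ j:]) *
                ((X + [:\<iota> * 16 ^ j:]) * (X - [:\<iota> * 16 ^ j:])) *
                (\<Prod>r = 1..n - 2.
                   (X ^ (2 ^ r) + [:\<iota> * 16 ^ j:]) * (X ^ (2 ^ r) - [:\<iota> * 16 ^ j:])))"
    (is "_ = ?R")
proof -
  define y where "y = (X :: 'a poly) ^ (4 * t)"
  have "?R = (X ^ (2 * t) - 1) * (X ^ (2 * t) + 1) *
      (\<Prod>r = 1..n - 2. \<Prod>j = 0..<t.
         (X ^ (2 ^ r) + [:\<iota> * 16 ^ j:]) * (X ^ (2 ^ r) - [:\<iota> * 16 ^ j:]))"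
    by (subst prod.swap) (simp only: prod.distrib prod_pm_16[symmetric] prod_pm_iota_16[symmetric])
  also have "(X ^ (2 * t) - 1) * (X ^ (2 * t) + 1) = y - 1"
  proof -
    have "y = X ^ (2 * t) * X ^ (2 * t)" unfolding y_def by (simp flip: power_add)
    then show ?thesis by (simp only: algebra_simps) simp
  qed
  also have "(\<Prod>r = 1..n - 2. \<Prod>j = 0..<t.
         (X ^ (2 ^ r) + [:\<iota> * 16 ^ j:]) * (X ^ (2 ^ r) - [:\<iota> * 16 ^ j:]))
      = (\<Prod>r = 1..n - 2. y ^ 2 ^ (r - 1) + 1)"
  proof (rule prod.cong[OF refl])
    fix r assume "r \<in> {1..n - 2}"
    then obtain k where r: "r = Suc k" by (cases r) auto
    have "((X :: 'a poly) ^ 2 ^ r) ^ (2 * t) = y ^ 2 ^ (r - 1)"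
      unfolding y_def power_mult[symmetric] by (simp add: r mult_ac)
    then show "(\<Prod>j = 0..<t. (X ^ 2 ^ r + [:\<iota> * 16 ^ j:]) * (X ^ 2 ^ r - [:\<iota> * 16 ^ j:]))
        = y ^ 2 ^ (r - 1) + 1"
      by (simp only: prod_pm_iota_16)
  qed
  also have "(y - 1) * \<dots> = y ^ 2 ^ (n - 2) - 1" by (rule prod_power_two_telescope)
  also have "y ^ 2 ^ (n - 2) = X ^ (2 ^ n * t)"
  proof -
    obtain m where "n = m + 2" using assms by (metis le_add_diff_inverse2)
    then show ?thesis
      unfolding y_def power_mult[symmetric] by (simp add: power_add mult_ac)
  qed
  finally show ?thesis by simp
qed

end

theorem theorem4p7:
  fixes q t n :: nat
    and \<iota> :: "'a::{field,finite}"
  assumes "prime q" and "odd q"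
    and "prime t" and "odd t"
    and "q = 4 * t + 1"
    and "CARD('a) = q"
    and "\<iota> ^ 2 = -1"
    and "n \<ge> 1"
  shows "(n \<ge> 2 \<longrightarrow>
           (X :: 'a poly) ^ (2 ^ n * t) - 1 =
             (\<Prod>j = 0..<t.
                (X + [:16 ^ j:]) * (X - [:16 ^ j:]) *
                ((X + [:\<iota> * 16 ^ j:]) * (X - [:\<iota> * 16 ^ j:])) *
                (\<Prod>r = 1..n - 2.
                   (X ^ (2 ^ r) + [:\<iota> * 16 ^ j:]) * (X ^ (2 ^ r) - [:\<iota> * 16 ^ j:])))
           \<and> size (displayed_factors \<iota> t n) = 2 * n * t
           \<and> (\<forall>p \<in># displayed_factors \<iota> t n. irreducible p))
       \<and> (n = 1 \<longrightarrow>
           (X :: 'a poly) ^ (2 ^ n * t) - 1 =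
             (\<Prod>j = 0..<t. (X + [:16 ^ j:]) * (X - [:16 ^ j:]))
           \<and> size (linear_factors t :: 'a poly multiset) = 2 * n * t
           \<and> (\<forall>p \<in># (linear_factors t :: 'a poly multiset). irreducible p))"
proof -
  interpret field_4t_plus_1 t \<iota>
    using assms by unfold_locales auto
  show ?thesis
  proof (intro conjI impI)
    assume n: "n \<ge> 2"
    show "(X :: 'a poly) ^ (2 ^ n * t) - 1 =
             (\<Prod>j = 0..<t.
                (X + [:16 ^ j:]) * (X - [:16 ^ j:]) *
                ((X + [:\<iota> * 16 ^ j:]) * (X - [:\<iota> * 16 ^ j:])) *
                (\<Prod>r = 1..n - 2.
                   (X ^ (2 ^ r) + [:\<iota> * 16 ^ j:]) * (X ^ (2 ^ r) - [:\<iota> * 16 ^ j:])))"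
      using n by (rule factorization)
    have "size (displayed_factors \<iota> t n) = t * (4 + (n - 2) * 2)"
      by (simp add: displayed_factors_def pm_factors_def algebra_simps)
    also have "4 + (n - 2) * 2 = 2 * n" using n by simp
    finally show "size (displayed_factors \<iota> t n) = 2 * n * t" by (simp only: mult.commute)
    show "\<forall>p \<in># displayed_factors \<iota> t n. irreducible p"
      using irreducible_linear_factors irreducible_binomials
      by (auto simp: displayed_factors_def pm_factors_def set_mset_sum
          simp del: add_pCons diff_pCons)
  next
    assume n: "n = 1"
    show "(X :: 'a poly) ^ (2 ^ n * t) - 1 =
             (\<Prod>j = 0..<t. (X + [:16 ^ j:]) * (X - [:16 ^ j:]))"
      using prod_pm_16[of X] by (simp only: n power_one_right)
    show "size (linear_factors t :: 'a poly multiset) = 2 * n * t"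
      by (simp add: linear_factors_def pm_factors_def n)
    show "\<forall>p \<in># (linear_factors t :: 'a poly multiset). irreducible p"
      using irreducible_linear_factors
      by (auto simp: linear_factors_def pm_factors_def set_mset_sum
          simp del: add_pCons diff_pCons)
  qed
qed

end
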